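(* Let $n$ be a non-negative integer. Then $$\sum_{k=0}^{n} (-1)^k \binom{n}{k} \frac{1}{nk+n-1} = n^n\, n! \prod_{k=0}^{n} \frac{1}{nk+n-1}.$$
   Context: Here $\binom{n}{k}$ denotes the binomial coefficient and $n!$ the factorial of $n$.
   Formalization: The case n = 1 is excluded, because there the denominator nk + n − 1 is zero at k = 0 and both sides are undefined; all other non-negative integers n, including 0 (with 0^0 = 1), are covered. *)

theory Defs
  imports Complex_Main
begin

end

theory Submission
  imports Defs
begin

(* The alternating binomial sum is an iterated difference of 1 / (a k + x), so Pascal's rule gives
   S(m+1, x) = S(m, x) - S(m, x + a); the product formula obeys the same recursion. *)

text \<open>The slope \<open>a\<close> and offset \<open>x\<close> are decoupled from the length
  \<open>m\<close>, so that induction on \<open>m\<close> can shift \<open>x\<close> to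
  \<open>x + a\<close>; the theorem is the case \<open>a = n\<close>, \<open>x = n - 1\<close>,
  \<open>m = n\<close>.\<close>

lemma alternating_binomial_sum_Suc:
  fixes f :: "nat \<Rightarrow> 'a::comm_ring_1"
  shows "(\<Sum>k\<le>Suc m. (- 1) ^ k * of_nat (Suc m choose k) * f k)
       = (\<Sum>k\<le>m. (- 1) ^ k * of_nat (m choose k) * f k)
         - (\<Sum>k\<le>m. (- 1) ^ k * of_nat (m choose k) * f (Suc k))"
proof -
  have "(\<Sum>k\<le>Suc m. (- 1) ^ k * of_nat (Suc m choose k) * f k)
      = f 0 + (\<Sum>k\<le>m. (- 1) ^ Suc k * of_nat (m choose Suc k) * f (Suc k))
        - (\<Sum>k\<le>m. (- 1) ^ k * of_nat (m choose k) * f (Suc k))"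
    by (subst sum.atMost_Suc_shift)
       (simp add: algebra_simps sum.distrib sum_negf sum_subtractf del: sum.atMost_Suc)
  \<comment> \<open>\<open>f 0\<close> is the missing term at index 0; the extra top term vanishes
    since \<open>m choose Suc m\<close> is 0.\<close>
  also have "f 0 + (\<Sum>k\<le>m. (- 1) ^ Suc k * of_nat (m choose Suc k) * f (Suc k))
      = (\<Sum>k\<le>Suc m. (- 1) ^ k * of_nat (m choose k) * f k)"
    by (subst sum.atMost_Suc_shift) simp
  also have "\<dots> = (\<Sum>k\<le>m. (- 1) ^ k * of_nat (m choose k) * f k)"
    by (simp add: binomial_eq_0)
  finally show ?thesis .
qed

lemma alternating_binomial_sum_inverse_linear:
  fixes a x :: "'a::field_char_0"
  assumes "\<And>k. k \<le> m \<Longrightarrow> a * of_nat k + x \<noteq> 0"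
  shows "(\<Sum>k\<le>m. (- 1) ^ k * of_nat (m choose k) * (1 / (a * of_nat k + x)))
       = a ^ m * fact m * (\<Prod>k\<le>m. 1 / (a * of_nat k + x))"
  using assms
proof (induction m arbitrary: x)
  case 0
  then show ?case by simp
next
  case (Suc m)
  let ?g = "\<lambda>k. 1 / (a * of_nat k + x)"
  have shift: "a * of_nat k + (x + a) = a * of_nat (Suc k) + x" for k
    by (simp add: algebra_simps)
  have nonzero: "x \<noteq> 0" "a * of_nat (Suc m) + x \<noteq> 0"
    using Suc.prems[of 0] Suc.prems[of "Suc m"] by simp_all
  have "(\<Sum>k\<le>m. (- 1) ^ k * of_nat (m choose k) * ?g k) = a ^ m * fact m * prod ?g {..m}"
    using Suc.prems by (intro Suc.IH) simp
  \<comment> \<open>Both shorter products are multiples of the full one: this one lacks its last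
    factor, the shifted one its first.\<close>
  moreover have "prod ?g {..m} = (a * of_nat (Suc m) + x) * prod ?g {..Suc m}"
    using nonzero by (simp del: of_nat_Suc)
  moreover have "(\<Sum>k\<le>m. (- 1) ^ k * of_nat (m choose k) * ?g (Suc k))
      = a ^ m * fact m * (\<Prod>k\<le>m. ?g (Suc k))"
    using Suc.IH[of "x + a"] Suc.prems unfolding shift by (metis Suc_le_mono)
  moreover have "(\<Prod>k\<le>m. ?g (Suc k)) = x * prod ?g {..Suc m}"
    using nonzero by (subst prod.atMost_Suc_shift) (simp del: of_nat_Suc)
  \<comment> \<open>The multipliers differ by
    \<open>(a * of_nat (Suc m) + x) - x = a * of_nat (Suc m)\<close>, which turns
    \<open>a ^ m * fact m\<close> into \<open>a ^ Suc m * fact (Suc m)\<close>.\<close>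
  ultimately show ?case
    unfolding alternating_binomial_sum_Suc by (simp only: power_Suc fact_Suc) (simp only: algebra_simps)
qed

(* For n = 1 the denominator n * k + n - 1 vanishes at k = 0, so neither side is defined there;
   every other natural number, including 0, is covered. *)
theorem theorem1:
  fixes n :: nat
  assumes "n \<noteq> 1"
  shows "(\<Sum>k=0..n. (- 1) ^ k * real (n choose k) * (1 / (real n * real k + real n - 1)))
       = real n ^ n * fact n * (\<Prod>k=0..n. 1 / (real n * real k + real n - 1))"
proof -
  \<comment> \<open>The value is -1 for \<open>n = 0\<close> and positive for
    \<open>n \<ge> 2\<close>.\<close>
  have "real n * real k + (real n - 1) \<noteq> 0" for k
  proof (cases "n = 0")
    case False
    with assms have "real n > 1" by simp
    then show ?thesis by (smt (verit) mult_nonneg_nonneg of_nat_0_le_iff)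
  qed simp
  then show ?thesis
    using alternating_binomial_sum_inverse_linear[of n "real n" "real n - 1"]
    by (simp add: atLeast0AtMost add_diff_eq)
qed

end
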